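(* Assume the learning-rate assumption and the smoothness assumption stated in the context. A measure $\bar\rho\in\mathcal P(K)$ is a stationary solution of $\partial_t\rho_t=2\zeta(t)\nabla_\omega\cdot\big(\rho_t\nabla_\omega\Phi(\omega;\rho_t)\big)$ if and only if $$\nabla_\omega\Phi(\omega;\bar\rho)=0\quad\text{for }\bar\rho\text{-almost every }\omega.$$ If $\nabla_\omega\Phi(\cdot;\bar\rho)$ is continuous, this is equivalent to $$\operatorname{supp}(\bar\rho)\subset\{\omega\in K:\nabla_\omega\Phi(\omega;\bar\rho)=0\}.$$
   Context: Model. Fix positive integers $L,d_x,d_k,d_v$ and a fixed matrix $W_{\mathrm{out}}\in\mathbb R^{d_x\times d_v}$. A head parameter is $\omega=(W_Q,W_K,W_V,W_O)\in\mathbb R^{d_x\times d_k}\times\mathbb R^{d_x\times d_k}\times\mathbb R^{d_x\times d_k}\times\mathbb R^{d_k\times d_x}$, identified with a vector in $\mathbb R^{d_\omega}$. For an input $X\in\mathbb R^{L\times d_x}$ (rows are tokens), the causally masked attention matrix $A_\omega(X)\in\mathbb R^{L\times L}$ has entries $$A_\omega(X)_{rs}=\frac{\exp\big((XW_QW_K^\top X^\top)_{rs}/\sqrt{d_k}\big)}{\sum_{s'\le r}\exp\big((XW_QW_K^\top X^\top)_{rs'}/\sqrt{d_k}\big)}\ (s\le r),\qquad A_\omega(X)_{rs}=0\ (s>r).$$ $\psi_l(X;\omega)\in\mathbb R^{d_v}$ is the $l$-th row of $A_\omega(X)XW_VW_OW_{\mathrm{out}}$, $l=1,\dots,L$. Data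 and first variation. $X$ is a random input and $Y_l(X)\in\mathbb R^{d_v}$ is a one-hot label for each $l$; $\mathbb E_X$ is expectation over $X$. $\mathrm{softmax}_j(z)=e^{z_j}/\sum_m e^{z_m}$. For a probability measure $\rho$ on $\mathbb R^{d_\omega}$, $z_l^\rho(X)=\int\psi_l(X;\omega)\,\rho(d\omega)$, and $$\Phi(\omega;\rho)=\mathbb E_X\Big[\frac1L\sum_{l=1}^L\big\langle\mathrm{softmax}(z_l^\rho(X))-Y_l(X),\psi_l(X;\omega)\big\rangle\Big].$$ Weak and stationary solutions. A weak solution of the PDE is a narrowly continuous curve $t\mapsto\rho_t\in\mathcal P(K)$ such that for every $f\in C^1(K)$, $\frac{d}{dt}\int f\,d\rho_t=-2\zeta(t)\int\langle\nabla f(\omega),\nabla_\omega\Phi(\omega;\rho_t)\rangle\,\rho_t(d\omega)$ in the sense of distributions in time. $\bar\rho$ is a stationary solution if the constant curve $\rho_t\equiv\bar\rho$ is a weak solution. Learning-rate assumption. $\zeta:[0,\infty)\to[0,\infty)$ is bounded and Lipschitz, and $\int_0^\infty\zeta(t)\,dt=\infty$. Smoothness assumption. $K\subset\mathbb R^{d_\omega}$ and $K_x\subset\mathbb R^{d_x}$ are compact, all measures considered are supported in $K$, all input tokens lie in $K_x$ (so $X\in K_x^L$), the maps $\omega\mapsto\psi_l(X;\omega)$ are $C^3$ on $K$ for all $l$ and almost every $X$, and there is $B_\psi<\infty$ with $$\sup_{X\in K_x^L,\,1\le l\le L,\,\omega\in K}\big(\|\psi_l(X;\omega)\|+\|\nabla_\omega\psi_l(X;\omega)\|+\|\nabla^2_\omega\psi_l(X;\omega)\|+\|\nabla^3_\omega\psi_l(X;\omega)\|\big)\le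 B_\psi.$$ *)

theory Defs
  imports "HOL-Probability.Probability"
begin

section \<open>The attention head\<close>

text \<open>
  Dimensions are carried by finite index types: \<open>'l\<close> for token positions (length L), \<open>'x\<close>, \<open>'k\<close>,
  \<open>'v\<close> for the three widths.  The causal mask needs an order on positions, so \<open>'l\<close> is moreover
  linearly ordered; a nonempty finite linear order is a copy of \<open>1 < \<dots> < L\<close>.

  A head parameter is the tuple \<open>(W\<^sub>Q, W\<^sub>K, W\<^sub>V, W\<^sub>O)\<close>.  The inner product of the product type
  is the sum of the entrywise inner products of the matrices, i.e. the one of the flattened vector.
\<close>

type_synonym ('m, 'n) rmatrix = "real^'n^'m"

type_synonym ('x, 'k) param =
  "('x, 'k) rmatrix \<times> ('x, 'k) rmatrix \<times> ('x, 'k) rmatrix \<times> ('k, 'x) rmatrix"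

definition scores ::
  "('x::finite, 'k::finite) param \<Rightarrow> ('l::finite, 'x) rmatrix \<Rightarrow> ('l, 'l) rmatrix" where
  "scores \<omega> X = (case \<omega> of (WQ, WK, WV, WO) \<Rightarrow> X ** WQ ** transpose WK ** transpose X)"

definition attention ::
  "('x::finite, 'k::finite) param \<Rightarrow> ('l::{finite,linorder}, 'x) rmatrix \<Rightarrow> ('l, 'l) rmatrix" where
  "attention \<omega> X = (\<chi> r s.
     if s \<le> r
     then exp (scores \<omega> X $ r $ s / sqrt (real CARD('k)))
          / (\<Sum>s'\<in>{..r}. exp (scores \<omega> X $ r $ s' / sqrt (real CARD('k))))
     else 0)"

definition psi ::
  "('x, 'v) rmatrix \<Rightarrow> 'l::{finite,linorder} \<Rightarrow> ('l, 'x) rmatrix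
   \<Rightarrow> ('x::finite, 'k::finite) param \<Rightarrow> (real, 'v::finite) vec" where
  "psi Wout l X \<omega> = (case \<omega> of (WQ, WK, WV, WO) \<Rightarrow>
     row l (attention \<omega> X ** X ** WV ** WO ** Wout))"

section \<open>First variation\<close>

definition softmax ::
  "(real, 'v::finite) vec \<Rightarrow> (real, 'v) vec" where
  "softmax z = (\<chi> j. exp (z $ j) / (\<Sum>m\<in>UNIV. exp (z $ m)))"

definition mean_output ::
  "('x, 'v) rmatrix \<Rightarrow> ('x::finite, 'k::finite) param measure \<Rightarrow> 'l::{finite,linorder}
   \<Rightarrow> ('l, 'x) rmatrix \<Rightarrow> (real, 'v::finite) vec" where
  "mean_output Wout \<rho> l X = (\<integral>\<omega>. psi Wout l X \<omega> \<partial>\<rho>)"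

text \<open>\<open>P\<close> is the law of the random input, \<open>Y X $ l\<close> the label at position \<open>l\<close>.\<close>

definition Phi ::
  "('x, 'v::finite) rmatrix \<Rightarrow> ('l::{finite,linorder}, 'x) rmatrix measure
   \<Rightarrow> (('l, 'x) rmatrix \<Rightarrow> ('l, 'v) rmatrix) \<Rightarrow> ('x::finite, 'k::finite) param measure
   \<Rightarrow> ('x, 'k) param \<Rightarrow> real" where
  "Phi Wout P Y \<rho> \<omega> =
     (\<integral>X. 1 / real CARD('l) *
        (\<Sum>l\<in>UNIV. (softmax (mean_output Wout \<rho> l X) - Y X $ l) \<bullet> psi Wout l X \<omega>) \<partial>P)"

definition one_hot ::
  "(real, 'v::finite) vec \<Rightarrow> bool" where
  "one_hot y \<longleftrightarrow> (\<exists>j. y = axis j 1)"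

section \<open>Differential calculus\<close>

text \<open>Both notions are meaningful only where the derivative exists.  Higher derivatives are iterates of
  \<open>fderiv\<close>, multilinear maps in curried form, and are measured in operator norm.\<close>

definition gradient :: "('a::real_inner \<Rightarrow> real) \<Rightarrow> 'a \<Rightarrow> 'a" where
  "gradient f x = (THE D. GDERIV f x :> D)"

definition fderiv ::
  "('a::real_normed_vector \<Rightarrow> 'b::real_normed_vector) \<Rightarrow> 'a \<Rightarrow> 'a \<Rightarrow>\<^sub>L 'b" where
  "fderiv f x = Blinfun (frechet_derivative f (at x))"

text \<open>
  On a compact set \<open>K\<close> without further structure, \<open>C\<^sup>k(K)\<close> consists of the functions that are
  \<open>C\<^sup>k\<close> on some open neighbourhood of \<open>K\<close>.
\<close>

definition C1_on :: "'a::real_normed_vector set \<Rightarrow> ('a \<Rightarrow> 'b::real_normed_vector) \<Rightarrow> bool" where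
  "C1_on K f \<longleftrightarrow> (\<exists>U. open U \<and> K \<subseteq> U \<and>
     (\<forall>x\<in>U. f differentiable (at x)) \<and> continuous_on U (fderiv f))"

definition C3_on :: "'a::real_normed_vector set \<Rightarrow> ('a \<Rightarrow> 'b::real_normed_vector) \<Rightarrow> bool" where
  "C3_on K f \<longleftrightarrow> (\<exists>U. open U \<and> K \<subseteq> U \<and>
     (\<forall>x\<in>U. f differentiable (at x) \<and> fderiv f differentiable (at x) \<and>
             fderiv (fderiv f) differentiable (at x)) \<and>
     continuous_on U (fderiv (fderiv (fderiv f))))"

section \<open>Measures on \<open>K\<close>\<close>

definition prob_measures_on :: "'a::topological_space set \<Rightarrow> 'a measure set" where
  "prob_measures_on K = {\<rho>. prob_space \<rho> \<and> sets \<rho> = sets (restrict_space borel K)}"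

text \<open>The measure may live on a subspace; it is understood to be extended by zero.\<close>

definition support :: "'a::topological_space measure \<Rightarrow> 'a set" where
  "support \<rho> = {x. \<forall>U. open U \<and> x \<in> U \<longrightarrow> emeasure \<rho> (U \<inter> space \<rho>) > 0}"

text \<open>Since \<open>K\<close> is compact, every continuous function on \<open>K\<close> is bounded.\<close>

definition narrowly_continuous ::
  "'a::topological_space set \<Rightarrow> (real \<Rightarrow> 'a measure) \<Rightarrow> bool" where
  "narrowly_continuous K \<rho> \<longleftrightarrow>
     (\<forall>g::'a \<Rightarrow> real. continuous_on K g \<longrightarrow> continuous_on {0..} (\<lambda>t. \<integral>\<omega>. g \<omega> \<partial>(\<rho> t)))"

section \<open>Weak and stationary solutions\<close>

text \<open>Test functions in \<open>C\<^sub>c\<^sup>\<infinity>((0,\<infinity>))\<close>.\<close>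

definition time_test_function :: "(real \<Rightarrow> real) \<Rightarrow> bool" where
  "time_test_function \<phi> \<longleftrightarrow>
     (\<forall>n t. (deriv ^^ n) \<phi> differentiable (at t)) \<and>
     (\<exists>a b. 0 < a \<and> (\<forall>t. t \<notin> {a..b} \<longrightarrow> \<phi> t = 0))"

definition has_distributional_deriv :: "(real \<Rightarrow> real) \<Rightarrow> (real \<Rightarrow> real) \<Rightarrow> bool" where
  "has_distributional_deriv m g \<longleftrightarrow>
     (\<forall>\<phi>. time_test_function \<phi> \<longrightarrow>
        - (LBINT t:{0<..}. m t * deriv \<phi> t) = (LBINT t:{0<..}. g t * \<phi> t))"

text \<open>
  Under the standing assumptions \<open>gradient f\<close> and \<open>gradient (Phi Wout P Y (\<rho> t))\<close> are continuous on the
  compact set \<open>K\<close>, so none of the integrals below takes the default value 0 of a non-integrable function.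
\<close>

definition weak_solution ::
  "('x, 'k) param set \<Rightarrow> ('x, 'v::finite) rmatrix \<Rightarrow> ('l::{finite,linorder}, 'x) rmatrix measure
   \<Rightarrow> (('l, 'x) rmatrix \<Rightarrow> ('l, 'v) rmatrix)
   \<Rightarrow> (real \<Rightarrow> real) \<Rightarrow> (real \<Rightarrow> ('x::finite, 'k::finite) param measure) \<Rightarrow> bool" where
  "weak_solution K Wout P Y \<zeta> \<rho> \<longleftrightarrow>
     (\<forall>t\<ge>0. \<rho> t \<in> prob_measures_on K) \<and>
     narrowly_continuous K \<rho> \<and>
     (\<forall>f::('x, 'k) param \<Rightarrow> real. C1_on K f \<longrightarrow>
        has_distributional_deriv
          (\<lambda>t. \<integral>\<omega>. f \<omega> \<partial>(\<rho> t))
          (\<lambda>t. - 2 * \<zeta> t * (\<integral>\<omega>. gradient f \<omega> \<bullet> gradient (Phi Wout P Y (\<rho> t)) \<omega> \<partial>(\<rho> t))))"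

definition stationary_solution ::
  "('x, 'k) param set \<Rightarrow> ('x, 'v::finite) rmatrix \<Rightarrow> ('l::{finite,linorder}, 'x) rmatrix measure
   \<Rightarrow> (('l, 'x) rmatrix \<Rightarrow> ('l, 'v) rmatrix)
   \<Rightarrow> (real \<Rightarrow> real) \<Rightarrow> ('x::finite, 'k::finite) param measure \<Rightarrow> bool" where
  "stationary_solution K Wout P Y \<zeta> \<rho> \<longleftrightarrow> weak_solution K Wout P Y \<zeta> (\<lambda>t. \<rho>)"

section \<open>Standing assumptions\<close>

text \<open>Only the values on \<open>[0,\<infinity>)\<close> matter.\<close>

definition learning_rate_assumption :: "(real \<Rightarrow> real) \<Rightarrow> bool" where
  "learning_rate_assumption \<zeta> \<longleftrightarrow>
     (\<forall>t\<ge>0. 0 \<le> \<zeta> t) \<and> bounded (\<zeta> ` {0..}) \<and> (\<exists>C. C-lipschitz_on {0..} \<zeta>) \<and>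
     (\<integral>\<^sup>+t\<in>{0..}. ennreal (\<zeta> t) \<partial>lborel) = \<infinity>"

definition inputs_from ::
  "(real, 'x) vec set \<Rightarrow> ('l::finite, 'x::finite) rmatrix set" where
  "inputs_from Kx = {X. \<forall>l. X $ l \<in> Kx}"

definition data_assumption ::
  "(real, 'x) vec set \<Rightarrow> ('l::finite, 'x::finite) rmatrix measure
   \<Rightarrow> (('l, 'x) rmatrix \<Rightarrow> ('l, 'v::finite) rmatrix) \<Rightarrow> bool" where
  "data_assumption Kx P Y \<longleftrightarrow>
     prob_space P \<and> sets P = sets borel \<and> (AE X in P. X \<in> inputs_from Kx) \<and>
     Y \<in> borel_measurable borel \<and> (\<forall>X\<in>inputs_from Kx. \<forall>l. one_hot (Y X $ l))"

definition smoothness_assumption ::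
  "('x, 'k::finite) param set \<Rightarrow> (real, 'x) vec set \<Rightarrow> ('x, 'v::finite) rmatrix
   \<Rightarrow> ('l::{finite,linorder}, 'x::finite) rmatrix measure \<Rightarrow> bool" where
  "smoothness_assumption K Kx Wout P \<longleftrightarrow>
     compact K \<and> compact Kx \<and>
     (AE X in P. \<forall>l. C3_on K (psi Wout l X)) \<and>
     (\<exists>B. \<forall>X\<in>(inputs_from Kx :: ('l, 'x) rmatrix set). \<forall>l. \<forall>\<omega>\<in>K.
        norm (psi Wout l X \<omega>) + norm (fderiv (psi Wout l X) \<omega>)
        + norm (fderiv (fderiv (psi Wout l X)) \<omega>)
        + norm (fderiv (fderiv (fderiv (psi Wout l X))) \<omega>) \<le> B)"

end

theory Submission imports Defs begin

text \<open>
  For a constant curve the time derivative vanishes, so a test function in time with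
  \<open>\<integral>\<zeta> \<phi> \<noteq> 0\<close> shows that stationarity means \<open>\<integral>\<langle>\<nabla>f, \<nabla>\<Phi>\<rangle> d\<rho> = 0\<close> for all \<open>f\<close> of class \<open>C\<^sup>1\<close>.
  The potential \<open>\<Phi>\<close> is itself such an \<open>f\<close>: the head output is an explicit \<open>C\<^sup>1\<close> function on the whole
  parameter space, the inputs range over a compact set, and the coefficients \<open>softmax - Y\<close> are bounded,
  so one can differentiate under the expectation. With \<open>f = \<Phi>\<close> the integral of \<open>|\<nabla>\<Phi>|\<^sup>2\<close> vanishes.
\<close>

section \<open>Smooth test functions in time\<close>

text \<open>The classical smooth function exp(-1/x), extended by 0 to x \<le> 0, with a polynomial
  factor in 1/x. Admitting every polynomial makes the family closed under differentiation.\<close>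

definition flat :: "real poly \<Rightarrow> real \<Rightarrow> real" where
  "flat p x = (if x \<le> 0 then 0 else poly p (inverse x) * exp (- inverse x))"

lemma poly_times_exp_minus_tendsto_0: "((\<lambda>x::real. poly p x * exp (- x)) \<longlongrightarrow> 0) at_top"
proof -
  have "((\<lambda>x::real. \<Sum>i\<le>degree p. coeff p i * (x ^ i / exp x)) \<longlongrightarrow> 0) at_top"
    by (intro tendsto_null_sum tendsto_mult_right_zero tendsto_power_div_exp_0)
  moreover have "poly p x * exp (- x) = (\<Sum>i\<le>degree p. coeff p i * (x ^ i / exp x))" for x
    by (simp add: poly_altdef sum_distrib_left exp_minus divide_inverse mult_ac)
  ultimately show ?thesis by simp
qed

text \<open>With u = 1/x one has d/dx = -u^2 d/du, which turns p(u) exp(-u) into u^2 (p - p')(u)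
  exp(-u); \<open>[:0, 0, 1:]\<close> is u^2. At 0 the exponential decay beats every polynomial in
  u.\<close>

lemma flat_has_derivative:
  "(flat p has_field_derivative flat ([:0, 0, 1:] * (p - pderiv p)) x) (at x)"
proof -
  consider "x < 0" | "x = 0" | "0 < x" by linarith
  then show ?thesis
  proof cases
    case 1
    have "(flat p has_field_derivative 0) (at x)"
      by (rule has_field_derivative_transform_within_open[where f = "\<lambda>_. 0" and S = "{..<0}"])
        (use 1 in \<open>auto simp: flat_def\<close>)
    then show ?thesis using 1 by (simp add: flat_def)
  next
    case 2
    \<comment> \<open>\<open>pCons 0 p\<close> multiplies p by its variable, which supplies the
      factor 1/h of the difference quotient at 0.\<close>
    have "((\<lambda>h. poly (pCons 0 p) (inverse h) * exp (- inverse h)) \<longlongrightarrow> 0) (at_right (0::real))"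
      by (rule filterlim_compose[OF poly_times_exp_minus_tendsto_0 filterlim_inverse_at_top_right])
    then have "((\<lambda>h. flat p h / h) \<longlongrightarrow> 0) (at_right 0)"
      by (rule Lim_transform_eventually)
        (auto simp: flat_def eventually_at_filter divide_inverse)
    moreover have "((\<lambda>h. flat p h / h) \<longlongrightarrow> 0) (at_left 0)"
      by (rule tendsto_eventually) (auto simp: flat_def eventually_at_filter)
    ultimately have "((\<lambda>h. flat p h / h) \<longlongrightarrow> 0) (at 0)"
      by (rule filterlim_split_at_real[rotated])
    then show ?thesis
      using 2 by (simp add: has_field_derivative_iff flat_def)
  next
    case 3
    have "((\<lambda>x. poly p (inverse x) * exp (- inverse x)) has_field_derivative
        flat ([:0, 0, 1:] * (p - pderiv p)) x) (at x)"
      using 3 by (auto intro!: derivative_eq_intros DERIV_chain2[OF poly_DERIV] simp: flat_def)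
        (simp add: algebra_simps power2_eq_square)
    then show ?thesis
      by (rule has_field_derivative_transform_within_open[where S = "{0<..}"])
        (use 3 in \<open>auto simp: flat_def\<close>)
  qed
qed

text \<open>A class stable under differentiation. The product rule forces sums; the minus sign
  coming from b - t is absorbed into the polynomial, so no scalar multiples have to be
  added.\<close>

inductive_set flat_products :: "real \<Rightarrow> real \<Rightarrow> (real \<Rightarrow> real) set" for a b where
  prod: "(\<lambda>t. flat p (t - a) * flat q (b - t)) \<in> flat_products a b"
| add: "f \<in> flat_products a b \<Longrightarrow> g \<in> flat_products a b \<Longrightarrow> (\<lambda>t. f t + g t) \<in> flat_products a b"

lemma flat_products_derivative:
  assumes "f \<in> flat_products a b"
  shows "\<exists>f' \<in> flat_products a b. \<forall>t. (f has_field_derivative f' t) (at t)"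
  using assms
proof induction
  case (prod p q)
  let ?d = "\<lambda>p. [:0, 0, 1:] * (p - pderiv p) :: real poly"
  have minus: "flat (- p) x = - flat p x" for p x by (simp add: flat_def)
  have "((\<lambda>t. flat p (t - a) * flat q (b - t)) has_field_derivative
      flat (?d p) (t - a) * flat q (b - t) + flat p (t - a) * flat (- ?d q) (b - t)) (at t)" for t
    unfolding minus
    by (rule derivative_eq_intros DERIV_chain2[OF flat_has_derivative] refl)+ simp
  then show ?case
    by (intro bexI[OF _ flat_products.add[OF flat_products.prod flat_products.prod]]) blast
next
  case (add f g)
  then obtain f' g' where "f' \<in> flat_products a b" "g' \<in> flat_products a b"
    and "\<forall>t. (f has_field_derivative f' t) (at t)" "\<forall>t. (g has_field_derivative g' t) (at t)"
    by blast
  then show ?case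
    by (intro bexI[of _ "\<lambda>t. f' t + g' t"] allI DERIV_add flat_products.add) auto
qed

lemma flat_products_funpow_deriv:
  "f \<in> flat_products a b \<Longrightarrow> (deriv ^^ n) f \<in> flat_products a b"
proof (induction n)
  case (Suc n)
  then obtain g where "g \<in> flat_products a b" "\<forall>t. ((deriv ^^ n) f has_field_derivative g t) (at t)"
    using flat_products_derivative by blast
  moreover from this have "deriv ((deriv ^^ n) f) = g" by (auto intro!: DERIV_imp_deriv)
  ultimately show ?case by simp
qed simp

text \<open>The bump is exp(-1/(t-a)) exp(-1/(b-t)) on (a,b) and 0 elsewhere. Its iterated
  derivatives stay in \<open>flat_products\<close>, hence all exist.\<close>

lemma bump_function_exists:
  assumes "0 < a" "a < b"
  obtains \<phi> where "time_test_function \<phi>" "\<And>t. 0 \<le> \<phi> t" "\<And>t. 0 < \<phi> t \<longleftrightarrow> a < t \<and> t < b"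
proof
  let ?\<phi> = "\<lambda>t. flat 1 (t - a) * flat 1 (b - t)"
  show "time_test_function ?\<phi>"
    unfolding time_test_function_def
  proof (intro conjI allI)
    fix n t
    have "(deriv ^^ n) ?\<phi> \<in> flat_products a b"
      by (intro flat_products_funpow_deriv flat_products.prod)
    then show "(deriv ^^ n) ?\<phi> differentiable at t"
      using flat_products_derivative real_differentiable_def by blast
  next
    show "\<exists>a b. 0 < a \<and> (\<forall>t. t \<notin> {a..b} \<longrightarrow> ?\<phi> t = 0)"
      by (rule exI[of _ a], rule exI[of _ b]) (use \<open>0 < a\<close> in \<open>auto simp: flat_def\<close>)
  qed
  show "0 \<le> ?\<phi> t" for t by (simp add: flat_def)
  show "0 < ?\<phi> t \<longleftrightarrow> a < t \<and> t < b" for t by (auto simp: flat_def)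
qed

section \<open>Testing in time\<close>

lemma time_test_function_deriv:
  assumes "time_test_function \<phi>"
  shows "(\<phi> has_field_derivative deriv \<phi> t) (at t)" "isCont (deriv \<phi>) t"
proof -
  have *: "\<forall>n t. (deriv ^^ n) \<phi> differentiable (at t)"
    using assms by (simp add: time_test_function_def)
  from *[rule_format, of 0 t] show "(\<phi> has_field_derivative deriv \<phi> t) (at t)"
    using real_differentiable_def DERIV_imp_deriv by fastforce
  from *[rule_format, of 1 t] show "isCont (deriv \<phi>) t"
    using differentiable_imp_continuous_within by fastforce
qed

text \<open>By the fundamental theorem the integral is a difference of two values of
  \<open>\<phi>\<close> outside its support. This is why a constant curve has distributional
  derivative 0.\<close>

lemma integral_deriv_time_test_function:
  assumes "time_test_function \<phi>"
  shows "(LBINT t:{0<..}. deriv \<phi> t) = 0"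
proof -
  obtain a b where ab: "0 < a" "\<And>t. t \<notin> {a..b} \<Longrightarrow> \<phi> t = 0"
    using assms unfolding time_test_function_def by blast
  \<comment> \<open>Both a/2 and \<open>c\<close> lie outside [a,b]. The maximum is taken because a
    \<le> b is not given; it ensures a/2 \<le> c in every case.\<close>
  define c where "c = max a b + 1"
  have outside: "deriv \<phi> t = 0" if "t \<notin> {a..b}" for t
  proof (rule DERIV_imp_deriv)
    show "(\<phi> has_field_derivative 0) (at t)"
      by (rule has_field_derivative_transform_within_open[where f = "\<lambda>_. 0" and S = "- {a..b}"])
        (use that ab in \<open>auto simp: open_Compl\<close>)
  qed
  have "(LBINT t:{0<..}. deriv \<phi> t) = (\<integral>t. deriv \<phi> t * indicator {a/2..c} t \<partial>lborel)"
    unfolding set_lebesgue_integral_def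
  proof (intro Bochner_Integration.integral_cong refl)
    fix t
    show "indicator {0<..} t *\<^sub>R deriv \<phi> t = deriv \<phi> t * indicator {a/2..c} t"
      using outside[of t] ab(1) by (cases "t \<in> {a..b}") (auto simp: indicator_def c_def)
  qed
  also have "\<dots> = \<phi> c - \<phi> (a/2)"
    using ab(1) by (intro integral_FTC_Icc_real time_test_function_deriv[OF assms])
      (auto simp: c_def)
  also have "\<dots> = 0"
    using ab(1) by (subst (1 2) ab(2)) (auto simp: c_def)
  finally show ?thesis .
qed

text \<open>A bump on (s/2, 2s) makes the integrand continuous, nonnegative and positive at s, so
  its integral cannot vanish.\<close>

lemma time_test_function_positive_integral:
  fixes \<zeta> :: "real \<Rightarrow> real"
  assumes "continuous_on {0..} \<zeta>" "\<And>t. 0 \<le> t \<Longrightarrow> 0 \<le> \<zeta> t" "0 < s" "0 < \<zeta> s"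
  obtains \<phi> where "time_test_function \<phi>" "(LBINT t:{0<..}. \<zeta> t * \<phi> t) \<noteq> 0"
proof -
  obtain \<phi> where \<phi>: "time_test_function \<phi>" "\<And>t. 0 \<le> \<phi> t"
    and pos: "\<And>t. 0 < \<phi> t \<longleftrightarrow> s / 2 < t \<and> t < 2 * s"
    using bump_function_exists[of "s/2" "2 * s"] \<open>0 < s\<close> by auto
  have cont: "continuous_on {s/2..2 * s} (\<lambda>t. \<zeta> t * \<phi> t)"
    using \<open>0 < s\<close> time_test_function_deriv(1)[OF \<phi>(1)]
    by (intro continuous_on_mult continuous_on_subset[OF assms(1)]
        continuous_at_imp_continuous_on ballI DERIV_isCont) auto
  have zero: "\<phi> t = 0" if "t \<notin> {s/2..2 * s}" for t
    using \<phi>(2)[of t] pos[of t] that by force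
  have "(LBINT t:{0<..}. \<zeta> t * \<phi> t) = (LBINT t:{s/2..2 * s}. \<zeta> t * \<phi> t)"
    unfolding set_lebesgue_integral_def
    using zero \<open>0 < s\<close> by (intro Bochner_Integration.integral_cong) (auto simp: indicator_def)
  also have "\<dots> = integral {s/2..2 * s} (\<lambda>t. \<zeta> t * \<phi> t)"
    by (intro set_borel_integral_eq_integral borel_integrable_atLeastAtMost' cont)
  also have "\<dots> \<noteq> 0"
    using \<open>0 < s\<close> assms(2,4) \<phi>(2) pos[of s]
    by (subst integral_eq_0_iff[OF cont]) (auto intro!: bexI[of _ s])
  finally show ?thesis using that \<phi>(1) by blast
qed

text \<open>Otherwise the integrand in the divergence condition vanishes off the null set {0}, and
  its integral is 0 instead of infinite.\<close>

lemma learning_rate_positive: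
  assumes "learning_rate_assumption \<zeta>"
  shows "\<exists>s>0. 0 < \<zeta> s"
proof (rule ccontr)
  assume "\<not> ?thesis"
  then have nonpos: "\<zeta> t \<le> 0" if "0 < t" for t
    using that by force
  have "AE t in lborel. ennreal (\<zeta> t) * indicator {0..} t = 0"
    using AE_lborel_singleton[of "0::real"]
    by eventually_elim (use nonpos in \<open>auto simp: indicator_def ennreal_neg\<close>)
  then have "(\<integral>\<^sup>+t\<in>{0..}. ennreal (\<zeta> t) \<partial>lborel) = (\<integral>\<^sup>+t. 0 \<partial>(lborel :: real measure))"
    by (rule nn_integral_cong_AE)
  then show False using assms by (simp add: learning_rate_assumption_def)
qed

section \<open>Functions that are continuously differentiable in the head parameter\<close>

text \<open>Here x is the variable of differentiation and y a parameter, later the input. Joint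
  continuity of the gradient gives uniformity in y over compact sets.\<close>

definition jointly_C1 :: "('a::real_inner \<Rightarrow> 'b::topological_space \<Rightarrow> real) \<Rightarrow> bool" where
  "jointly_C1 g \<longleftrightarrow> (\<exists>g'. (\<forall>x y. GDERIV (\<lambda>x. g x y) x :> g' x y) \<and>
     continuous_on UNIV (\<lambda>(x, y). g x y) \<and> continuous_on UNIV (\<lambda>(x, y). g' x y))"

lemma jointly_C1_E:
  assumes "jointly_C1 g"
  obtains g' where "\<And>x y. GDERIV (\<lambda>x. g x y) x :> g' x y"
    "continuous_on UNIV (\<lambda>z. g (fst z) (snd z))" "continuous_on UNIV (\<lambda>z. g' (fst z) (snd z))"
  using assms unfolding jointly_C1_def case_prod_beta by blast

lemma jointly_C1_I:
  assumes "\<And>x y. GDERIV (\<lambda>x. g x y) x :> g' x y"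
    "continuous_on UNIV (\<lambda>z. g (fst z) (snd z))" "continuous_on UNIV (\<lambda>z. g' (fst z) (snd z))"
  shows "jointly_C1 g"
  using assms unfolding jointly_C1_def case_prod_beta by blast

lemma continuous_on_slice:
  assumes "continuous_on UNIV (\<lambda>z. h (fst z) (snd z))"
  shows "continuous_on UNIV (h x)"
  using continuous_on_compose2[OF assms continuous_on_Pair[OF continuous_on_const[of UNIV x] continuous_on_id]]
  by simp

lemma jointly_C1_imp_continuous:
  "jointly_C1 g \<Longrightarrow> continuous_on UNIV (\<lambda>z. g (fst z) (snd z))"
  by (erule jointly_C1_E)

lemma jointly_C1_parameter:
  assumes "continuous_on UNIV f"
  shows "jointly_C1 (\<lambda>_ y. f y)"
  by (rule jointly_C1_I[where g' = "\<lambda>_ _. 0"])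
    (auto intro!: GDERIV_const continuous_on_compose2[OF assms] continuous_on_snd continuous_on_id)

text \<open>The gradient is the constant vector that represents the functional \<open>f\<close> with
  respect to the orthonormal \<open>Basis\<close>.\<close>

lemma jointly_C1_linear:
  fixes f :: "'a::euclidean_space \<Rightarrow> real"
  assumes "bounded_linear f"
  shows "jointly_C1 (\<lambda>x _. f x)"
proof (rule jointly_C1_I)
  interpret bounded_linear f by fact
  have "f = (\<lambda>h. h \<bullet> (\<Sum>b\<in>Basis. f b *\<^sub>R b))"
  proof
    fix h
    have "f h = f (\<Sum>b\<in>Basis. (h \<bullet> b) *\<^sub>R b)" by (simp add: euclidean_representation)
    then show "f h = h \<bullet> (\<Sum>b\<in>Basis. f b *\<^sub>R b)"
      by (simp add: sum scaleR inner_sum_right mult.commute)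
  qed
  then show "GDERIV f x :> (\<Sum>b\<in>Basis. f b *\<^sub>R b)" for x
    unfolding gderiv_def by (metis bounded_linear_imp_has_derivative assms)
qed (auto intro!: continuous_on_compose2[OF linear_continuous_on[OF assms]] continuous_intros)

section \<open>Closure under algebraic operations\<close>

lemma jointly_C1_add:
  assumes "jointly_C1 f" "jointly_C1 g"
  shows "jointly_C1 (\<lambda>x y. f x y + g x y)"
  using assms
  by (elim jointly_C1_E, intro jointly_C1_I[where g = "\<lambda>x y. f x y + g x y"])
    (rule GDERIV_add, assumption, assumption, auto intro: continuous_intros)

lemma jointly_C1_mult:
  assumes "jointly_C1 f" "jointly_C1 g"
  shows "jointly_C1 (\<lambda>x y. f x y * g x y)"
  using assms
  by (elim jointly_C1_E, intro jointly_C1_I[where g = "\<lambda>x y. f x y * g x y"])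
    (rule GDERIV_mult, assumption, assumption, auto intro: continuous_intros)

lemma jointly_C1_inverse:
  assumes "jointly_C1 f" "\<And>x y. f x y \<noteq> 0"
  shows "jointly_C1 (\<lambda>x y. inverse (f x y))"
  using assms
  by (elim jointly_C1_E, intro jointly_C1_I[where g = "\<lambda>x y. inverse (f x y)"])
    (rule GDERIV_inverse, assumption, assumption, auto intro!: continuous_intros)

lemma jointly_C1_exp:
  assumes "jointly_C1 f"
  shows "jointly_C1 (\<lambda>x y. exp (f x y))"
  using assms
  by (elim jointly_C1_E, intro jointly_C1_I[where g = "\<lambda>x y. exp (f x y)"])
    (rule GDERIV_DERIV_compose, assumption, rule DERIV_exp, auto intro: continuous_intros)

lemma jointly_C1_sum:
  "(\<And>i. i \<in> I \<Longrightarrow> jointly_C1 (f i)) \<Longrightarrow> jointly_C1 (\<lambda>x y. \<Sum>i\<in>I. f i x y)"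
  by (induction I rule: infinite_finite_induct)
    (auto intro: jointly_C1_parameter jointly_C1_add continuous_intros)

lemma jointly_C1_matrix_mult:
  assumes "\<And>i k. jointly_C1 (\<lambda>x y. A x y $ i $ k)" "\<And>k j. jointly_C1 (\<lambda>x y. B x y $ k $ j)"
  shows "jointly_C1 (\<lambda>x y. (A x y ** B x y) $ i $ j)"
  unfolding matrix_matrix_mult_def by (simp add: jointly_C1_sum jointly_C1_mult assms)

lemma jointly_C1_transpose:
  "jointly_C1 (\<lambda>x y. A x y $ j $ i) \<Longrightarrow> jointly_C1 (\<lambda>x y. transpose (A x y) $ i $ j)"
  by (simp add: transpose_def)

lemma continuous_on_matrix_entry: "continuous_on S (\<lambda>X. X $ i $ j)"
  by (intro continuous_intros)

lemma bounded_linear_matrix_entry: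
  "bounded_linear f \<Longrightarrow> bounded_linear (\<lambda>x. f x $ i $ j)"
  by (intro bounded_linear_compose[OF bounded_linear_vec_nth])

section \<open>Scores, attention and head output\<close>

lemma jointly_C1_scores:
  "jointly_C1 (\<lambda>\<omega> X. scores (\<omega> :: ('x::finite, 'k::finite) param) (X :: ('l::finite, 'x) rmatrix) $ r $ s)"
  unfolding scores_def case_prod_beta
  by (rule jointly_C1_transpose jointly_C1_matrix_mult jointly_C1_parameter jointly_C1_linear
      bounded_linear_matrix_entry continuous_on_matrix_entry bounded_linear_intros)+

lemma jointly_C1_attention:
  "jointly_C1 (\<lambda>\<omega> X. attention (\<omega> :: ('x::finite, 'k::finite) param)
     (X :: ('l::{finite,linorder}, 'x) rmatrix) $ r $ s)"
proof (cases "s \<le> r")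
  case True
  \<comment> \<open>The range contains r, so the softmax denominator is a nonempty sum of
    exponentials and never vanishes.\<close>
  have "(\<Sum>s'\<in>{..r}. exp (f s')) \<noteq> (0::real)" for f
    using sum_pos[of "{..r}" "\<lambda>s'. exp (f s' :: real)"] by force
  with True show ?thesis
    unfolding attention_def divide_inverse
    by (simp add: jointly_C1_mult jointly_C1_inverse jointly_C1_exp jointly_C1_sum jointly_C1_scores
        jointly_C1_parameter)
next
  case False
  then show ?thesis by (simp add: attention_def jointly_C1_parameter)
qed

text \<open>The regularity holds on the whole parameter space, so no neighbourhood of
  \<open>K\<close> depending on the input has to be chosen.\<close>

lemma jointly_C1_psi:
  fixes Wout :: "('x::finite, 'v::finite) rmatrix"
  shows "jointly_C1 (\<lambda>\<omega> X. psi Wout (l::'l::{finite,linorder}) X (\<omega> :: ('x, 'k::finite) param) $ j)"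
  unfolding psi_def row_def case_prod_beta vec_lambda_beta
  by (rule jointly_C1_attention jointly_C1_matrix_mult jointly_C1_parameter jointly_C1_linear
      bounded_linear_matrix_entry continuous_on_matrix_entry continuous_on_const
      bounded_linear_intros)+

section \<open>Differentiation under the expectation\<close>

text \<open>A continuous function is bounded on the compact set carrying the finite measure, so the
  product with \<open>c\<close> is almost everywhere bounded.\<close>

lemma integrable_bounded_times_continuous:
  fixes f :: "'a::topological_space \<Rightarrow> 'b::{banach,second_countable_topology}"
  assumes "finite_measure M" "sets M = sets borel" "compact C" "AE y in M. y \<in> C"
    and "c \<in> borel_measurable M" "AE y in M. \<bar>c y\<bar> \<le> B" "continuous_on UNIV f"
  shows "integrable M (\<lambda>y. c y *\<^sub>R f y)"
proof -
  interpret finite_measure M by fact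
  have "compact (f ` C)"
    using compact_continuous_image[OF continuous_on_subset[OF assms(7) subset_UNIV] assms(3)] .
  from compact_imp_bounded[OF this] obtain b where b: "\<And>y. y \<in> C \<Longrightarrow> norm (f y) \<le> b"
    unfolding bounded_iff by auto
  show ?thesis
  proof (rule integrable_const_bound)
    show "AE y in M. norm (c y *\<^sub>R f y) \<le> B * b"
      using assms(4,6)
    proof eventually_elim
      case (elim y)
      have "\<bar>c y\<bar> * norm (f y) \<le> B * b"
        using elim b[of y] by (intro mult_mono) auto
      then show ?case by simp
    qed
    have "f \<in> borel_measurable M"
      using borel_measurable_continuous_onI[OF assms(7)] measurable_cong_sets[OF assms(2) refl]
      by blast
    then show "(\<lambda>y. c y *\<^sub>R f y) \<in> borel_measurable M"
      using assms(5) by measurable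
  qed
qed

text \<open>On the compact set that carries the measure, \<open>g' z y\<close> is close to \<open>g' x y\<close> uniformly in \<open>y\<close> once
  \<open>z\<close> is close to \<open>x\<close>; this yields both the derivative and its continuity.\<close>

lemma gradient_of_integral:
  fixes g :: "'b::euclidean_space \<Rightarrow> 'a::topological_space \<Rightarrow> real"
  assumes "prob_space M" "sets M = sets borel" "compact C" "AE y in M. y \<in> C"
    and "c \<in> borel_measurable M" "AE y in M. \<bar>c y\<bar> \<le> B" "jointly_C1 g"
  obtains G where "\<And>x. GDERIV (\<lambda>x. \<integral>y. c y * g x y \<partial>M) x :> G x" "continuous_on UNIV G"
proof -
  interpret prob_space M by fact
  from assms(7) obtain g' where g': "\<And>x y. GDERIV (\<lambda>x. g x y) x :> g' x y"
    and cont: "continuous_on UNIV (\<lambda>z. g (fst z) (snd z))"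
    and cont': "continuous_on UNIV (\<lambda>z. g' (fst z) (snd z))"
    using jointly_C1_E by blast
  note int = integrable_bounded_times_continuous[OF finite_measure_axioms assms(2-6) continuous_on_slice[OF cont]]
  note int' = integrable_bounded_times_continuous[OF finite_measure_axioms assms(2-6) continuous_on_slice[OF cont']]
  define F where "F x = (\<integral>y. c y * g x y \<partial>M)" for x
  define G where "G x = (\<integral>y. c y *\<^sub>R g' x y \<partial>M)" for x
  \<comment> \<open>A probability space is not null, so the almost sure bound holds at some point;
    this yields B \<ge> 0.\<close>
  have "\<exists>y. \<bar>c y\<bar> \<le> B"
    using AE_contr[OF assms(6)] not_empty by (metis (mono_tags, lifting) assms(6) eventually_mono)
  then have "0 \<le> B" by (metis abs_ge_zero order_trans)
  \<comment> \<open>The tube lemma over the compact set \<open>C\<close>. Dividing by B + 1 instead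
    of B allows B = 0 and leaves an error of at most e after multiplication by
    \<open>c y\<close>.\<close>
  have close: "\<exists>d>0. \<forall>z. norm (z - x) < d \<longrightarrow> (\<forall>y\<in>C. norm (g' z y - g' x y) \<le> e / (B + 1))"
    if "e > 0" for x e
  proof -
    have "0 < e / (B + 1)" using that \<open>0 \<le> B\<close> by simp
    from continuous_on_prod_compactE[OF continuous_on_subset[OF cont'] assms(3) UNIV_I this]
    obtain X where "x \<in> X" "open X" and
      X: "\<forall>z\<in>X. \<forall>y\<in>C. dist (g' z y) (g' x y) \<le> e / (B + 1)"
      by (metis Int_UNIV_right fst_conv snd_conv subset_UNIV)
    then obtain d where "d > 0" "ball x d \<subseteq> X" using open_contains_ball by blast
    with X show ?thesis
      by (intro exI[of _ d]) (auto simp: dist_norm subset_iff norm_minus_commute)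
  qed
  have scale: "B * (e / (B + 1)) \<le> e" if "e > 0" for e
    using that \<open>0 \<le> B\<close> by (simp add: field_simps)
  have bound: "norm (integral\<^sup>L M h) \<le> e"
    if "integrable M h" "AE y in M. norm (h y) \<le> e" for e and h :: "'a \<Rightarrow> 'c::{banach,second_countable_topology}"
  proof -
    have "norm (integral\<^sup>L M h) \<le> (\<integral>y. norm (h y) \<partial>M)" by (rule integral_norm_bound)
    also have "\<dots> \<le> (\<integral>y. e \<partial>M)" using that by (intro integral_mono_AE) auto
    finally show ?thesis by (simp add: prob_space)
  qed
  have "continuous_on UNIV G"
    unfolding continuous_on_iff
  proof (intro ballI allI impI)
    fix x and e :: real assume "e > 0"
    then have "e / 2 > 0" by simp
    from close[OF this, of x] obtain d where "d > 0" and d: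
      "\<And>z y. norm (z - x) < d \<Longrightarrow> y \<in> C \<Longrightarrow> norm (g' z y - g' x y) \<le> e / 2 / (B + 1)" by blast
    have "dist (G z) (G x) < e" if "dist z x < d" for z
    proof -
      have "AE y in M. norm (c y *\<^sub>R g' z y - c y *\<^sub>R g' x y) \<le> e / 2"
        using assms(4,6)
      proof eventually_elim
        case (elim y)
        have "\<bar>c y\<bar> * norm (g' z y - g' x y) \<le> B * (e / 2 / (B + 1))"
          using elim d[of z y] that \<open>0 \<le> B\<close> by (intro mult_mono) (auto simp: dist_norm)
        also note scale[OF \<open>e / 2 > 0\<close>]
        finally show ?case by (simp add: scaleR_diff_right[symmetric])
      qed
      from bound[OF _ this] have "norm (G z - G x) \<le> e / 2"
        unfolding G_def by (simp add: int' Bochner_Integration.integral_diff)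
      with \<open>e > 0\<close> show ?thesis by (simp add: dist_norm)
    qed
    with \<open>d > 0\<close> show "\<exists>d>0. \<forall>x'\<in>UNIV. dist x' x < d \<longrightarrow> dist (G x') (G x) < e" by blast
  qed
  moreover have "GDERIV F x :> G x" for x
    unfolding gderiv_def has_derivative_at_alt
  proof (intro conjI allI impI bounded_linear_inner_left)
    fix e :: real assume "e > 0"
    from close[OF this, of x] obtain d where "d > 0" and d:
      "\<And>z y. norm (z - x) < d \<Longrightarrow> y \<in> C \<Longrightarrow> norm (g' z y - g' x y) \<le> e / (B + 1)" by blast
    have "norm (F z - F x - (z - x) \<bullet> G x) \<le> e * norm (z - x)" if z: "norm (z - x) < d" for z
    proof -
      \<comment> \<open>Mean value inequality on the segment from x to z: throughout the ball the
        derivative differs from that at x by at most e / (B + 1), uniformly in y.\<close>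
      have linearized: "\<bar>g z y - g x y - (z - x) \<bullet> g' x y\<bar> \<le> norm (z - x) * (e / (B + 1))" if "y \<in> C" for y
      proof -
        have "norm (g z y - g x y - (z - x) \<bullet> g' x y) \<le> norm (z - x) * (e / (B + 1))"
        proof (rule differentiable_bound_linearization[where S = "ball x d" and f' = "\<lambda>w h. h \<bullet> g' w y"])
          show "x + t *\<^sub>R (z - x) \<in> ball x d" if "t \<in> {0..1}" for t
          proof -
            have "\<bar>t\<bar> * norm (z - x) \<le> 1 * norm (z - x)" using that by (intro mult_right_mono) auto
            then show ?thesis using z by (simp add: dist_norm)
          qed
          show "((\<lambda>x. g x y) has_derivative (\<lambda>h. h \<bullet> g' w y)) (at w within ball x d)" for w
            using g'[of y w] has_derivative_at_withinI unfolding gderiv_def by blast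
          show "onorm ((\<lambda>h. h \<bullet> g' w y) - (\<lambda>h. h \<bullet> g' x y)) \<le> e / (B + 1)" if "w \<in> ball x d" for w
          proof (rule onorm_bound)
            show "0 \<le> e / (B + 1)" using \<open>e > 0\<close> \<open>0 \<le> B\<close> by simp
            fix h
            have "\<bar>h \<bullet> (g' w y - g' x y)\<bar> \<le> norm h * norm (g' w y - g' x y)"
              by (rule Cauchy_Schwarz_ineq2)
            also have "\<dots> \<le> norm h * (e / (B + 1))"
              using that d[of w y] \<open>y \<in> C\<close>
              by (intro mult_left_mono) (auto simp: dist_norm norm_minus_commute)
            finally show "norm (((\<lambda>h. h \<bullet> g' w y) - (\<lambda>h. h \<bullet> g' x y)) h) \<le> e / (B + 1) * norm h"
              by (simp add: inner_diff_right mult.commute)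
          qed
        qed (use \<open>d > 0\<close> in simp)
        then show ?thesis by simp
      qed
      have "AE y in M. norm (c y * g z y - c y * g x y - (z - x) \<bullet> (c y *\<^sub>R g' x y)) \<le> e * norm (z - x)"
        using assms(4,6)
      proof eventually_elim
        case (elim y)
        have "norm (c y * g z y - c y * g x y - (z - x) \<bullet> (c y *\<^sub>R g' x y)) =
            \<bar>c y\<bar> * \<bar>g z y - g x y - (z - x) \<bullet> g' x y\<bar>"
          by (simp add: abs_mult[symmetric] right_diff_distrib)
        also have "\<dots> \<le> B * (norm (z - x) * (e / (B + 1)))"
          using elim linearized[of y] \<open>0 \<le> B\<close> by (intro mult_mono) auto
        also have "\<dots> = (B * (e / (B + 1))) * norm (z - x)" by simp
        also have "\<dots> \<le> e * norm (z - x)"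
          using scale[OF \<open>e > 0\<close>] by (rule mult_right_mono) simp
        finally show ?case .
      qed
      note remainder = this
      have hz: "integrable M (\<lambda>y. c y * g z y)" and hx: "integrable M (\<lambda>y. c y * g x y)"
        using int[of z] int[of x] by simp_all
      have hl: "integrable M (\<lambda>y. (z - x) \<bullet> (c y *\<^sub>R g' x y))"
        by (intro integrable_inner_right int')
      have "(\<integral>y. c y * g z y - c y * g x y - (z - x) \<bullet> (c y *\<^sub>R g' x y) \<partial>M) =
          F z - F x - (z - x) \<bullet> G x"
        unfolding F_def G_def Bochner_Integration.integral_diff[OF Bochner_Integration.integrable_diff[OF hz hx] hl]
          Bochner_Integration.integral_diff[OF hz hx] integral_inner_right[OF int'] ..
      with bound[OF Bochner_Integration.integrable_diff[OF Bochner_Integration.integrable_diff[OF hz hx] hl] remainder]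
      show ?thesis by simp
    qed
    with \<open>d > 0\<close> show "\<exists>d>0. \<forall>z. norm (z - x) < d \<longrightarrow>
        norm (F z - F x - (z - x) \<bullet> G x) \<le> e * norm (z - x)" by blast
  qed
  ultimately show ?thesis using that unfolding F_def by blast
qed

section \<open>Gradients and C1 test functions\<close>

lemma gradient_eqI: "GDERIV f x :> D \<Longrightarrow> gradient f x = D"
  unfolding gradient_def
proof (rule the_equality)
  fix D' assume "GDERIV f x :> D" "GDERIV f x :> D'"
  then have "(\<lambda>h. h \<bullet> D) = (\<lambda>h. h \<bullet> D')" unfolding gderiv_def by (rule has_derivative_unique)
  then have "h \<bullet> D = h \<bullet> D'" for h by (rule fun_cong)
  then show "D' = D" using vector_eq_ldot[of D D'] by simp
qed

text \<open>The derivative at x is the functional h \<mapsto> h \<bullet> G x, which depends on G x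
  through a bounded linear map; the neighbourhood can be the whole space.\<close>

lemma C1_on_of_gradient:
  assumes "\<And>x. GDERIV f x :> G x" "continuous_on UNIV G"
  shows "C1_on K f"
  unfolding C1_on_def
proof (intro exI[of _ UNIV] conjI ballI)
  show "f differentiable at x" for x
    using assms(1) unfolding gderiv_def differentiable_def by blast
  have "frechet_derivative f (at x) = (\<lambda>h. h \<bullet> G x)" for x
    using assms(1)[of x] unfolding gderiv_def by (rule frechet_derivative_at[symmetric])
  then have "fderiv f = (\<lambda>x. blinfun_inner_left (G x))"
    by (auto intro!: ext blinfun_eqI simp: fderiv_def bounded_linear_Blinfun_apply bounded_linear_inner_left)
  then show "continuous_on UNIV (fderiv f)"
    using bounded_linear.continuous_on[OF bounded_linear_blinfun_inner_left assms(2)] by simp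
qed auto

section \<open>Bounds on predictions, labels and inputs\<close>

lemma abs_softmax_le_1: "\<bar>softmax z $ j\<bar> \<le> 1"
proof -
  have "exp (z $ j) \<le> (\<Sum>m\<in>UNIV. exp (z $ m))" by (rule member_le_sum) auto
  moreover from this have "0 < (\<Sum>m\<in>UNIV. exp (z $ m))"
    using exp_gt_zero less_le_trans by blast
  ultimately show ?thesis by (simp add: softmax_def)
qed

lemma abs_one_hot_le_1: "one_hot y \<Longrightarrow> \<bar>y $ j\<bar> \<le> 1"
  by (auto simp: one_hot_def axis_def)

text \<open>Heine-Borel: the norm is at most the sum of the row norms, and each row condition is
  closed.\<close>

lemma compact_inputs_from:
  assumes "compact Kx"
  shows "compact (inputs_from Kx :: ('l::finite, 'x::finite) rmatrix set)"
  unfolding compact_eq_bounded_closed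
proof
  from compact_imp_bounded[OF assms] obtain B where B: "\<And>x. x \<in> Kx \<Longrightarrow> norm x \<le> B"
    unfolding bounded_iff by blast
  have "norm X \<le> (\<Sum>l\<in>(UNIV::'l set). B)" if "X \<in> inputs_from Kx" for X :: "('l, 'x) rmatrix"
  proof -
    have "norm X \<le> (\<Sum>l\<in>UNIV. norm (X $ l))" unfolding norm_vec_def by (rule L2_set_le_sum) simp
    also have "\<dots> \<le> (\<Sum>l\<in>(UNIV::'l set). B)" using that B by (intro sum_mono) (simp add: inputs_from_def)
    finally show ?thesis .
  qed
  then show "bounded (inputs_from Kx :: ('l, 'x) rmatrix set)" unfolding bounded_iff by blast
  have "closed {X :: ('l, 'x) rmatrix. X $ l \<in> Kx}" for l
    using continuous_closed_vimage[OF compact_imp_closed[OF assms], of "\<lambda>X::('l, 'x) rmatrix. X $ l"]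
    by (simp add: vimage_def)
  then show "closed (inputs_from Kx :: ('l, 'x) rmatrix set)"
    unfolding inputs_from_def by (rule closed_Collect_all)
qed

section \<open>The first variation\<close>

lemma space_prob_measures_on:
  assumes "\<rho> \<in> prob_measures_on K"
  shows "space \<rho> = K"
proof -
  have "sets \<rho> = sets (restrict_space borel K)" using assms by (simp add: prob_measures_on_def)
  from sets_eq_imp_space_eq[OF this] show ?thesis by (simp add: space_restrict_space)
qed

lemma measurable_prob_measures_on:
  assumes "\<rho> \<in> prob_measures_on K" "f \<in> borel_measurable borel"
  shows "f \<in> borel_measurable \<rho>"
proof -
  have "sets \<rho> = sets (restrict_space borel K)" using assms(1) by (simp add: prob_measures_on_def)
  from measurable_cong_sets[OF this refl] show ?thesis
    using measurable_restrict_space1[OF assms(2), of K] by blast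
qed

text \<open>Joint continuity makes the integrand measurable on the product space, and integrating
  out the head parameter preserves measurability in the input.\<close>

lemma measurable_mean_output:
  fixes Wout :: "('x::finite, 'v::finite) rmatrix" and K :: "('x, 'k::finite) param set"
  assumes "\<rho> \<in> prob_measures_on K"
  shows "(mean_output Wout \<rho> (l::'l::{finite,linorder})) \<in> borel_measurable borel"
proof -
  interpret prob_space \<rho> using assms by (simp add: prob_measures_on_def)
  have "continuous_on UNIV (\<lambda>z. psi Wout l (snd z) (fst z :: ('x, 'k) param) $ j)" for j
    by (rule jointly_C1_imp_continuous[OF jointly_C1_psi])
  then have "continuous_on UNIV (\<lambda>z. \<chi> j. psi Wout l (snd z) (fst z :: ('x, 'k) param) $ j)"
    by (rule continuous_on_vec_lambda)
  then have "continuous_on UNIV (\<lambda>z. psi Wout l (snd z) (fst z :: ('x, 'k) param))"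
    by (simp only: vec_lambda_eta)
  then have psi: "(\<lambda>z. psi Wout l (snd z) (fst z :: ('x, 'k) param)) \<in> borel_measurable (borel \<Otimes>\<^sub>M borel)"
    unfolding borel_prod by (rule borel_measurable_continuous_onI)
  have "(\<lambda>\<omega>. \<omega>) \<in> measurable \<rho> borel"
    by (rule measurable_prob_measures_on[OF assms]) simp
  then have "(\<lambda>z. (snd z, fst z)) \<in> measurable (borel \<Otimes>\<^sub>M \<rho>) (borel \<Otimes>\<^sub>M borel)"
    by measurable
  from measurable_compose[OF this psi]
  have "case_prod (\<lambda>X. psi Wout l X) \<in> borel_measurable (borel \<Otimes>\<^sub>M \<rho>)"
    by (simp add: case_prod_beta)
  then show ?thesis
    unfolding mean_output_def by (intro borel_measurable_lebesgue_integral)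
qed

lemma borel_measurable_vec_component:
  "f \<in> borel_measurable M \<Longrightarrow> (\<lambda>x. f x $ i :: 'b::{real_normed_vector}) \<in> borel_measurable M"
  by (erule measurable_compose, intro borel_measurable_continuous_onI continuous_intros)

text \<open>In coordinates the potential is a finite sum of expectations of
  \<open>c l j X * psi Wout l X \<omega> $ j\<close>. The coefficients do not depend on
  \<open>\<omega>\<close> and are bounded by 2, so each summand can be differentiated under the
  expectation.\<close>

lemma Phi_gradient:
  fixes Wout :: "('x::finite, 'v::finite) rmatrix"
    and P :: "('l::{finite,linorder}, 'x) rmatrix measure"
    and K :: "('x, 'k::finite) param set"
  assumes "data_assumption Kx P Y" "compact Kx" "\<rho> \<in> prob_measures_on K"
  obtains G where "\<And>\<omega>. GDERIV (Phi Wout P Y \<rho>) \<omega> :> G \<omega>" "continuous_on UNIV G"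
proof -
  let ?C = "inputs_from Kx :: ('l, 'x) rmatrix set"
  have P: "prob_space P" "sets P = sets borel" and carrier: "AE X in P. X \<in> ?C"
    and Y: "Y \<in> borel_measurable borel" "\<And>X l. X \<in> ?C \<Longrightarrow> one_hot (Y X $ l)"
    using assms(1) by (auto simp: data_assumption_def)
  interpret P: prob_space P by fact
  note C = compact_inputs_from[OF assms(2)]
  define c where "c l j X = softmax (mean_output Wout \<rho> l X) $ j - Y X $ l $ j" for l j X
  have c_measurable: "c l j \<in> borel_measurable P" for l j
  proof -
    note [measurable] = borel_measurable_vec_component[OF measurable_mean_output[OF assms(3)]]
      borel_measurable_vec_component[OF borel_measurable_vec_component[OF Y(1)]]
    have "c l j \<in> borel_measurable borel"
      unfolding c_def softmax_def vec_lambda_beta by measurable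
    then show ?thesis using measurable_cong_sets[OF P(2) refl] by blast
  qed
  have c_bound: "AE X in P. \<bar>c l j X\<bar> \<le> 2" for l j
    using carrier
  proof eventually_elim
    case (elim X)
    then show ?case
      using abs_softmax_le_1[of "mean_output Wout \<rho> l X" j] abs_one_hot_le_1[OF Y(2), of X l j]
      unfolding c_def by linarith
  qed
  define F where "F l j \<omega> = (\<integral>X. c l j X * psi Wout l X \<omega> $ j \<partial>P)" for l j and \<omega> :: "('x, 'k) param"
  have F: "GDERIV (F l j) \<omega> :> gradient (F l j) \<omega>" "continuous_on UNIV (gradient (F l j))" for l j \<omega>
  proof -
    obtain G where G: "\<And>\<omega>. GDERIV (F l j) \<omega> :> G \<omega>" "continuous_on UNIV G"
      unfolding F_def
      by (rule gradient_of_integral[OF P C carrier c_measurable c_bound jointly_C1_psi]) blast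
    then have "gradient (F l j) = G" by (intro ext gradient_eqI)
    with G show "GDERIV (F l j) \<omega> :> gradient (F l j) \<omega>" "continuous_on UNIV (gradient (F l j))"
      by simp_all
  qed
  have "continuous_on UNIV (\<lambda>X. psi Wout l X (\<omega> :: ('x, 'k) param) $ j)" for l j \<omega>
    by (rule continuous_on_slice[OF jointly_C1_imp_continuous[OF jointly_C1_psi]])
  note int = integrable_bounded_times_continuous[OF P.finite_measure_axioms P(2) C carrier
      c_measurable c_bound this, unfolded real_scaleR_def]
  have "(softmax (mean_output Wout \<rho> l X) - Y X $ l) \<bullet> psi Wout l X \<omega> =
      (\<Sum>j\<in>UNIV. c l j X * psi Wout l X \<omega> $ j)" for l X and \<omega> :: "('x, 'k) param"
    by (simp add: inner_vec_def c_def)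
  then have Phi_eq: "Phi Wout P Y \<rho> = (\<lambda>\<omega>. 1 / real CARD('l) * (\<Sum>l\<in>UNIV. \<Sum>j\<in>UNIV. F l j \<omega>))"
    by (intro ext) (simp add: Phi_def F_def int)
  show thesis
  proof
    show "GDERIV (Phi Wout P Y \<rho>) \<omega> :>
        (1 / real CARD('l)) *\<^sub>R (\<Sum>l\<in>UNIV. \<Sum>j\<in>UNIV. gradient (F l j) \<omega>)" for \<omega>
      using F(1) unfolding Phi_eq gderiv_def inner_sum_right inner_scaleR_right
      by (intro has_derivative_mult_right has_derivative_sum)
    show "continuous_on UNIV (\<lambda>\<omega>. (1 / real CARD('l)) *\<^sub>R (\<Sum>l\<in>UNIV. \<Sum>j\<in>UNIV. gradient (F l j) \<omega>))"
      by (intro continuous_intros F(2))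
  qed
qed

section \<open>Stationary solutions\<close>

text \<open>The complement of the support is the union of all open null sets; by Lindelof countably
  many of them suffice, so it is null.\<close>

lemma AE_in_support:
  fixes \<rho> :: "'a::second_countable_topology measure"
  assumes "\<And>U. open U \<Longrightarrow> U \<inter> space \<rho> \<in> sets \<rho>"
  shows "AE x in \<rho>. x \<in> support \<rho>"
proof -
  define \<U> where "\<U> = {U. open U \<and> emeasure \<rho> (U \<inter> space \<rho>) = 0}"
  have "- support \<rho> = \<Union>\<U>"
    unfolding support_def \<U>_def by (auto simp: zero_less_iff_neq_zero)
  moreover obtain \<V> where \<V>: "\<V> \<subseteq> \<U>" "countable \<V>" "\<Union>\<V> = \<Union>\<U>"
    using Lindelof[of \<U>] unfolding \<U>_def by blast
  moreover have null: "(\<Union>U\<in>\<V>. U \<inter> space \<rho>) \<in> null_sets \<rho>"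
    using \<V>(1,2) assms by (intro null_sets_UN') (auto simp: null_sets_def \<U>_def)
  ultimately have "{x \<in> space \<rho>. x \<notin> support \<rho>} \<subseteq> (\<Union>U\<in>\<V>. U \<inter> space \<rho>)"
    by auto
  with null show ?thesis by (rule AE_I')
qed

lemma AE_zero_iff_support_subset:
  fixes f :: "'a::{second_countable_topology,t2_space} \<Rightarrow> 'b::t1_space"
  assumes "\<rho> \<in> prob_measures_on K" "compact K" "continuous_on K f"
  shows "(AE x in \<rho>. f x = z) \<longleftrightarrow> support \<rho> \<subseteq> {x \<in> K. f x = z}"
proof
  have sets: "sets \<rho> = sets (restrict_space borel K)"
    using assms(1) by (simp add: prob_measures_on_def)
  note space = space_prob_measures_on[OF assms(1)]
  have open_sets: "U \<inter> space \<rho> \<in> sets \<rho>" if "open U" for U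
    unfolding sets space sets_restrict_space using that by (auto simp: Int_commute)
  {
    assume "support \<rho> \<subseteq> {x \<in> K. f x = z}"
    then show "AE x in \<rho>. f x = z"
      using AE_in_support[OF open_sets] by (auto elim: eventually_mono)
  next
    assume AE: "AE x in \<rho>. f x = z"
    show "support \<rho> \<subseteq> {x \<in> K. f x = z}"
    proof (rule subsetI, rule ccontr)
      fix x assume x: "x \<in> support \<rho>" "x \<notin> {x \<in> K. f x = z}"
      obtain W where W: "open W" "W \<inter> K = f -` (- {z}) \<inter> K"
        using assms(3) unfolding continuous_on_open_invariant
        by (metis open_Compl closed_singleton)
      \<comment> \<open>Adding the complement of the closed set \<open>K\<close> covers points x
        outside \<open>K\<close> as well and leaves the trace on \<open>space \<rho>\<close>, which
        is \<open>K\<close>, unchanged.\<close>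
      have "open (W \<union> - K)" "x \<in> W \<union> - K"
        using W x(2) compact_imp_closed[OF assms(2)] by (auto simp: open_Compl)
      then have "emeasure \<rho> ((W \<union> - K) \<inter> space \<rho>) > 0" using x(1) by (simp add: support_def)
      moreover have "(W \<union> - K) \<inter> space \<rho> = {x \<in> space \<rho>. f x \<noteq> z}"
        using W(2) space by auto
      ultimately have "\<not> (AE x in \<rho>. f x = z)"
        using open_sets[OF \<open>open (W \<union> - K)\<close>] AE_iff_measurable[of _ \<rho> "\<lambda>x. f x = z"] by simp
      with AE show False by blast
    qed
  }
qed

text \<open>For a constant curve the weak equation reads 0 = -2 I(f) \<integral>\<zeta>\<phi> for
  all \<open>\<phi>\<close>, where I(f) does not depend on time. One \<open>\<phi>\<close> with
  nonzero \<integral>\<zeta>\<phi> forces I(f) = 0.\<close>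

lemma stationary_solution_iff:
  fixes \<rho> :: "('x::finite, 'k::finite) param measure"
  assumes "\<rho> \<in> prob_measures_on K"
    and "continuous_on {0..} \<zeta>" "\<And>t. 0 \<le> t \<Longrightarrow> 0 \<le> \<zeta> t" "0 < s" "0 < \<zeta> s"
  shows "stationary_solution K Wout P Y \<zeta> \<rho> \<longleftrightarrow>
    (\<forall>f. C1_on K f \<longrightarrow> (\<integral>\<omega>. gradient f \<omega> \<bullet> gradient (Phi Wout P Y \<rho>) \<omega> \<partial>\<rho>) = 0)"
proof -
  define I where "I f = (\<integral>\<omega>. gradient f \<omega> \<bullet> gradient (Phi Wout P Y \<rho>) \<omega> \<partial>\<rho>)" for f
  obtain \<phi>\<^sub>0 where \<phi>\<^sub>0: "time_test_function \<phi>\<^sub>0" "(LBINT t:{0<..}. \<zeta> t * \<phi>\<^sub>0 t) \<noteq> 0"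
    using time_test_function_positive_integral[of \<zeta> s] assms(2-5) by blast
  have rhs: "(LBINT t:{0<..}. - 2 * \<zeta> t * I f * \<phi> t) = - 2 * I f * (LBINT t:{0<..}. \<zeta> t * \<phi> t)" for f \<phi>
    by (subst set_integral_mult_right[symmetric]) (simp add: mult_ac)
  have lhs: "(LBINT t:{0<..}. m * deriv \<phi> t) = 0" if "time_test_function \<phi>" for m \<phi>
    using integral_deriv_time_test_function[OF that] by simp
  have "has_distributional_deriv (\<lambda>t. m) (\<lambda>t. - 2 * \<zeta> t * I f) \<longleftrightarrow> I f = 0" for m f
    unfolding has_distributional_deriv_def rhs using \<phi>\<^sub>0 by (auto simp del: set_integral_mult_right simp: lhs)
  then show ?thesis
    unfolding stationary_solution_def weak_solution_def narrowly_continuous_def I_def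
    using assms(1) by simp
qed

theorem theorem6p3:
  fixes Wout :: "('x::finite, 'v::finite) rmatrix"
    and P :: "('l::{finite,linorder}, 'x) rmatrix measure"
    and Y :: "('l, 'x) rmatrix \<Rightarrow> ('l, 'v) rmatrix"
    and K :: "('x, 'k::finite) param set"
    and Kx :: "(real, 'x) vec set"
    and \<zeta> :: "real \<Rightarrow> real"
    and \<rho> :: "('x, 'k) param measure"
  assumes "data_assumption Kx P Y"
    and "learning_rate_assumption \<zeta>"
    and "smoothness_assumption K Kx Wout P"
    and "\<rho> \<in> prob_measures_on K"
  shows "(stationary_solution K Wout P Y \<zeta> \<rho> \<longleftrightarrow>
            (AE \<omega> in \<rho>. gradient (Phi Wout P Y \<rho>) \<omega> = 0)) \<and>
         (continuous_on K (gradient (Phi Wout P Y \<rho>)) \<longrightarrow>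
            ((AE \<omega> in \<rho>. gradient (Phi Wout P Y \<rho>) \<omega> = 0) \<longleftrightarrow>
             support \<rho> \<subseteq> {\<omega> \<in> K. gradient (Phi Wout P Y \<rho>) \<omega> = 0}))"
proof (intro conjI impI AE_zero_iff_support_subset[OF assms(4)])
  have K: "compact K" "compact Kx" using assms(3) by (simp_all add: smoothness_assumption_def)
  \<comment> \<open>The equivalence with the support is \<open>AE_zero_iff_support_subset\<close>;
    its continuity premise is the antecedent of the implication.\<close>
  then show "compact K" by simp
  interpret prob_space \<rho> using assms(4) by (simp add: prob_measures_on_def)
  define \<Phi> where "\<Phi> = Phi Wout P Y \<rho>"
  obtain G where G: "\<And>\<omega>. GDERIV \<Phi> \<omega> :> G \<omega>" "continuous_on UNIV G"
    using Phi_gradient[OF assms(1) K(2) assms(4)] unfolding \<Phi>_def by blast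
  have grad: "gradient \<Phi> = G" by (intro ext gradient_eqI G)
  \<comment> \<open>Integrability matters here: the integral of a non-integrable function is 0 by
    default, and then a zero integral would say nothing about \<open>G\<close>.\<close>
  have "integrable \<rho> (\<lambda>\<omega>. G \<omega> \<bullet> G \<omega>)"
  proof -
    have "compact ((\<lambda>\<omega>. G \<omega> \<bullet> G \<omega>) ` K)"
      by (intro compact_continuous_image K continuous_intros continuous_on_subset[OF G(2)]) auto
    from compact_imp_bounded[OF this] obtain B where B: "\<And>\<omega>. \<omega> \<in> K \<Longrightarrow> norm (G \<omega> \<bullet> G \<omega>) \<le> B"
      unfolding bounded_iff by auto
    show ?thesis
      using B G(2) space_prob_measures_on[OF assms(4)]
      by (intro integrable_const_bound[of _ B] AE_I2 measurable_prob_measures_on[OF assms(4)]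
          borel_measurable_continuous_onI continuous_intros) auto
  qed
  then have square: "(\<integral>\<omega>. G \<omega> \<bullet> G \<omega> \<partial>\<rho>) = 0 \<longleftrightarrow> (AE \<omega> in \<rho>. G \<omega> = 0)"
    by (subst integral_nonneg_eq_0_iff_AE) auto
  from assms(2) obtain C where "C-lipschitz_on {0..} \<zeta>" "\<And>t. 0 \<le> t \<Longrightarrow> 0 \<le> \<zeta> t"
    unfolding learning_rate_assumption_def by blast
  moreover obtain s where "0 < s" "0 < \<zeta> s" using learning_rate_positive[OF assms(2)] by blast
  ultimately have stationary: "stationary_solution K Wout P Y \<zeta> \<rho> \<longleftrightarrow>
      (\<forall>f. C1_on K f \<longrightarrow> (\<integral>\<omega>. gradient f \<omega> \<bullet> G \<omega> \<partial>\<rho>) = 0)"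
    using stationary_solution_iff[OF assms(4)] lipschitz_on_continuous_on
    unfolding grad[symmetric] \<Phi>_def by blast
  show "stationary_solution K Wout P Y \<zeta> \<rho> \<longleftrightarrow>
      (AE \<omega> in \<rho>. gradient (Phi Wout P Y \<rho>) \<omega> = 0)"
    unfolding \<Phi>_def[symmetric] grad
  proof
    assume "stationary_solution K Wout P Y \<zeta> \<rho>"
    \<comment> \<open>The potential of the fixed measure \<open>\<rho>\<close> serves as its own
      test function.\<close>
    then have "(\<integral>\<omega>. gradient \<Phi> \<omega> \<bullet> G \<omega> \<partial>\<rho>) = 0"
      unfolding stationary using C1_on_of_gradient[OF G] by blast
    then show "AE \<omega> in \<rho>. G \<omega> = 0" unfolding grad square .
  next
    assume "AE \<omega> in \<rho>. G \<omega> = 0"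
    then have "(\<integral>\<omega>. gradient f \<omega> \<bullet> G \<omega> \<partial>\<rho>) = 0" for f
      by (intro integral_eq_zero_AE) (auto elim: eventually_mono)
    then show "stationary_solution K Wout P Y \<zeta> \<rho>" unfolding stationary by blast
  qed
qed

end
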